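(* Let $(X,\mathcal{S})$ be an $S$-metric space, let $x_0\in X$, $r\in(0,\infty)$, and let $C_{x_0,r}^{S}$ be the circle centered at $x_0$ with radius $r$. Define $\varphi:X\to[0,\infty)$ by $\varphi(x)=\mathcal{S}(x,x,x_0)$ for all $x\in X$. If $T:X\to X$ is a self-mapping satisfying $$\mathcal{S}(x,x,Tx)\leq \varphi(x)+\varphi(Tx)-2r$$ and $$\mathcal{S}(x,x,Tx)+\mathcal{S}(Tx,Tx,x_0)\leq r$$ for all $x\in C_{x_0,r}^{S}$, then $C_{x_0,r}^{S}$ is a fixed circle of $T$.
   Context: An $S$-metric on a nonempty set $X$ is a function $\mathcal{S}:X^3\to[0,\infty)$ such that for all $x,y,z,a\in X$: (1) $\mathcal{S}(x,y,z)=0$ if and only if $x=y=z$; (2) $\mathcal{S}(x,y,z)\leq \mathcal{S}(x,x,a)+\mathcal{S}(y,y,a)+\mathcal{S}(z,z,a)$. The pair $(X,\mathcal{S})$ is then called an $S$-metric space. For $x_0\in X$ and $r\in(0,\infty)$, the circle centered at $x_0$ with radius $r$ is $C_{x_0,r}^{S}=\{x\in X:\mathcal{S}(x,x,x_0)=r\}$. For a self-mapping $T:X\to X$, the circle $C_{x_0,r}^{S}$ is said to be a fixed circle of $T$ if $Tx=x$ for all $x\in C_{x_0,r}^{S}$. *)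

theory Defs
  imports Complex_Main "HOL-Library.FuncSet"
begin

text \<open>As for \<^verbatim>\<open>Metric_space\<close> in the library, the underlying set is an explicit carrier
  \<open>X\<close>, and \<open>S\<close> is only constrained on \<open>X\<close>.\<close>

locale S_metric_space =
  fixes X :: "'a set" and S :: "'a \<Rightarrow> 'a \<Rightarrow> 'a \<Rightarrow> real"
  assumes nonempty: "X \<noteq> {}"
    and nonneg: "\<lbrakk>x \<in> X; y \<in> X; z \<in> X\<rbrakk> \<Longrightarrow> 0 \<le> S x y z"
    and zero_iff: "\<lbrakk>x \<in> X; y \<in> X; z \<in> X\<rbrakk> \<Longrightarrow> S x y z = 0 \<longleftrightarrow> x = y \<and> y = z"
    and triangle: "\<lbrakk>x \<in> X; y \<in> X; z \<in> X; a \<in> X\<rbrakk> \<Longrightarrow> S x y z \<le> S x x a + S y y a + S z z a"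

definition S_circle :: "'a set \<Rightarrow> ('a \<Rightarrow> 'a \<Rightarrow> 'a \<Rightarrow> real) \<Rightarrow> 'a \<Rightarrow> real \<Rightarrow> 'a set" where
  "S_circle X S x0 r = {x \<in> X. S x x x0 = r}"

definition fixed_circle ::
  "'a set \<Rightarrow> ('a \<Rightarrow> 'a \<Rightarrow> 'a \<Rightarrow> real) \<Rightarrow> 'a \<Rightarrow> real \<Rightarrow> ('a \<Rightarrow> 'a) \<Rightarrow> bool" where
  "fixed_circle X S x0 r T \<longleftrightarrow> (\<forall>x \<in> S_circle X S x0 r. T x = x)"

end

theory Submission
  imports Defs
begin

text \<open>On the circle \<open>\<phi> x = r\<close>, so the first inequality bounds \<open>S x x (T x)\<close> by the excess
  \<open>\<phi> (T x) - r\<close>, while the second bounds it by the deficit \<open>r - \<phi> (T x)\<close>. Adding the two gives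
  \<open>2 * S x x (T x) \<le> 0\<close>, and then nonnegativity and the zero axiom force \<open>T x = x\<close>.\<close>

theorem theorem3p1:
  fixes X :: "'a set" and S :: "'a \<Rightarrow> 'a \<Rightarrow> 'a \<Rightarrow> real"
    and x0 :: 'a and r :: real and \<phi> :: "'a \<Rightarrow> real" and T :: "'a \<Rightarrow> 'a"
  assumes "S_metric_space X S"
    and "x0 \<in> X" and "0 < r"
    and "\<And>x. x \<in> X \<Longrightarrow> \<phi> x = S x x x0"
    and "T \<in> X \<rightarrow> X"
    and "\<And>x. x \<in> S_circle X S x0 r \<Longrightarrow> S x x (T x) \<le> \<phi> x + \<phi> (T x) - 2 * r"
    and "\<And>x. x \<in> S_circle X S x0 r \<Longrightarrow> S x x (T x) + S (T x) (T x) x0 \<le> r"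
  shows "fixed_circle X S x0 r T"
proof -
  interpret S_metric_space X S by fact
  have "T x = x" if "x \<in> S_circle X S x0 r" for x
  proof -
    have "x \<in> X" and "S x x x0 = r"
      using that by (auto simp: S_circle_def)
    moreover have "T x \<in> X"
      using \<open>x \<in> X\<close> assms(5) by auto
    ultimately have "S x x (T x) \<le> S (T x) (T x) x0 - r"
      using assms(6)[OF that] assms(4) by simp
    with assms(7)[OF that] have "S x x (T x) \<le> 0"
      by simp
    with nonneg[OF \<open>x \<in> X\<close> \<open>x \<in> X\<close> \<open>T x \<in> X\<close>] have "S x x (T x) = 0"
      by simp
    with zero_iff[OF \<open>x \<in> X\<close> \<open>x \<in> X\<close> \<open>T x \<in> X\<close>] show "T x = x"
      by simp
  qed
  then show ?thesis
    by (simp add: fixed_circle_def)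
qed

end
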